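(* For real $\beta$ let $f_\beta(z)=\frac{1}{(1-z)^{2+\beta}}$, $z\in\mathbf{D}$ (principal branch). (i) If $\beta>-\frac32$, then $f_\beta\in\mathbb{A}^2_\alpha\setminus\mathbb{A}^2_{2+2\beta}$ for every $\alpha>2+2\beta$. (ii) If $\beta=-\frac32$, then $f_\beta\in\mathbb{A}^2_\alpha\setminus H^2(\mathbf{D})$ for every $\alpha>-1$. (iii) If $\beta<-\frac32$, then $f_\beta\in H^2(\mathbf{D})$.
   Context: $\mathbf{D}$ is the open unit disc. For $\alpha>-1$, $\mathbb{A}^2_\alpha$ is the space of holomorphic functions $f$ on $\mathbf{D}$ with $\int_{\mathbf{D}}|f|^2\,dA_\alpha<\infty$, where $dA_\alpha(z)=(1+\alpha)(1-|z|^2)^\alpha dA(z)$ and $dA=dx\,dy/\pi$. $H^2(\mathbf{D})$ is the Hardy space of holomorphic $f(z)=\sum_{k\ge0}a_kz^k$ on $\mathbf{D}$ with $\sum_{k\ge 0}|a_k|^2<\infty$. *)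

theory Defs
  imports "HOL-Complex_Analysis.Complex_Analysis"
begin

abbreviation unit_disc :: "complex set" where
  "unit_disc \<equiv> ball 0 1"

(* dA = dx dy / pi on the unit disc, so that the disc has area 1 *)
definition disc_area :: "complex measure" where
  "disc_area = density (restrict_space lborel unit_disc) (\<lambda>z. ennreal (1 / pi))"

definition weighted_area :: "real \<Rightarrow> complex measure" where
  "weighted_area \<alpha> =
     density disc_area (\<lambda>z. ennreal ((1 + \<alpha>) * (1 - (cmod z)\<^sup>2) powr \<alpha>))"

(* Functions on the disc are represented by total functions on the complex plane; membership in the
   two spaces below depends only on the values on the disc. *)

(* Meaningful for \<alpha> > -1 only. *)
definition bergman_space :: "real \<Rightarrow> (complex \<Rightarrow> complex) set" where
  "bergman_space \<alpha> =
     {f. f holomorphic_on unit_disc \<and>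
         (\<integral>\<^sup>+z. ennreal ((cmod (f z))\<^sup>2) \<partial>weighted_area \<alpha>) < \<infinity>}"

definition hardy_space :: "(complex \<Rightarrow> complex) set" where
  "hardy_space =
     {f. f holomorphic_on unit_disc \<and>
         (\<exists>a. (\<forall>z\<in>unit_disc. (\<lambda>k. a k * z ^ k) sums f z) \<and>
              summable (\<lambda>k. (cmod (a k))\<^sup>2))}"

(* powr on complex numbers is the principal branch exp (w * Ln z). *)
definition f_pow :: "real \<Rightarrow> complex \<Rightarrow> complex" where
  "f_pow \<beta> z = 1 / (1 - z) powr complex_of_real (2 + \<beta>)"

end

(* The disc and its weights are rotation invariant, so integrating |f|^2 over circles first makes the
   monomials orthogonal, and a power series sum a_k z^k has squared norm
     sum |a_k|^2 k! / pochhammer (alpha + 2) k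
   in the weighted Bergman space: |z|^2 is uniformly distributed on [0,1] under normalized area, so
   the norms of the monomials are Beta integrals.  The coefficients of f_beta are
   pochhammer (2 + beta) k / k!, and pochhammer s k / k! is asymptotic to k^(s-1) / Gamma s.  Hence
   membership in a space amounts to convergence of sum k^p, with p = 2 beta + 1 - alpha for the
   Bergman space and p = 2 + 2 beta for the Hardy space. *)

theory Submission
  imports Defs
begin

section \<open>Invariance of Lebesgue measure under orthogonal maps\<close>

lemma nn_integral_lborel_translate:
  fixes f :: "'a::euclidean_space \<Rightarrow> ennreal"
  assumes [measurable]: "f \<in> borel_measurable borel"
  shows "(\<integral>\<^sup>+x. f (c + x) \<partial>lborel) = (\<integral>\<^sup>+x. f x \<partial>lborel)"
proof -
  have "(\<integral>\<^sup>+x. f x \<partial>lborel) = (\<integral>\<^sup>+x. f x \<partial>distr lborel borel ((+) c))"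
    by (simp add: lborel_distr_plus)
  then show ?thesis
    by (simp add: nn_integral_distr)
qed

lemma nn_integral_lborel_reflect:
  fixes f :: "'a::euclidean_space \<Rightarrow> ennreal"
  assumes [measurable]: "f \<in> borel_measurable borel"
  shows "(\<integral>\<^sup>+x. f (- x) \<partial>lborel) = (\<integral>\<^sup>+x. f x \<partial>lborel)"
proof -
  have "lborel = distr lborel borel (\<lambda>x::'a. - x)"
    using lborel_affine[of "-1" "0::'a"] by (simp add: density_1)
  then have "(\<integral>\<^sup>+x. f x \<partial>lborel) = (\<integral>\<^sup>+x. f x \<partial>distr lborel borel (\<lambda>x::'a. - x))"
    by simp
  then show ?thesis
    by (simp add: nn_integral_distr)
qed

text \<open>
  With M the image measure and B the unit ball, integrating A (T x) B (T x + y) over x and y in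
  either order gives M(A) |B| = |A| M(B), using only translation invariance; and M(B) = |B|.
\<close>
lemma distr_lborel_orthogonal:
  fixes T :: "'a::euclidean_space \<Rightarrow> 'a"
  assumes T: "orthogonal_transformation T"
  shows "distr lborel borel T = lborel"
proof (rule measure_eqI)
  fix A assume "A \<in> sets (distr lborel borel T)"
  then have A[measurable]: "A \<in> sets borel" by simp
  have lin: "linear T" and nrm: "norm (T x) = norm x" for x
    using T orthogonal_transformation by blast+
  have [measurable]: "T \<in> borel_measurable borel"
    using lin by (intro borel_measurable_continuous_onI linear_continuous_on
        linear_conv_bounded_linear[THEN iffD1])
  \<comment> \<open>A right inverse of \<open>T\<close>: replacing x by \<open>S y + x\<close> below
    turns \<open>T x\<close> into \<open>y + T x\<close>, so a translation of the image becomes a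
    translation of the variable.\<close>
  obtain S where S: "\<And>x. T (S x) = x"
    using orthogonal_transformation_surj[OF T] by (metis surjD)
  define B :: "'a set" where "B = ball 0 1"
  have [measurable]: "B \<in> sets borel" by (simp add: B_def)
  let ?M = "distr lborel borel T"
  let ?i = "\<lambda>A x. indicator A x :: ennreal"
  have M: "(\<integral>\<^sup>+x. ?i C (T x) \<partial>lborel) = emeasure ?M C" if [measurable]: "C \<in> sets borel" for C
    using nn_integral_distr[of T lborel borel "?i C"] by simp
  have MB: "emeasure ?M B = emeasure lborel B"
  proof -
    have "T -` B = B" by (auto simp: B_def nrm)
    then show ?thesis by (simp add: emeasure_distr)
  qed
  have "emeasure ?M A * emeasure lborel B
      = (\<integral>\<^sup>+x. ?i A (T x) * (\<integral>\<^sup>+y. ?i B (T x + y) \<partial>lborel) \<partial>lborel)"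
    by (subst nn_integral_lborel_translate) (auto simp: nn_integral_multc M)
  also have "\<dots> = (\<integral>\<^sup>+x. \<integral>\<^sup>+y. ?i A (T x) * ?i B (T x + y) \<partial>lborel \<partial>lborel)"
    by (simp add: nn_integral_cmult)
  also have "\<dots> = (\<integral>\<^sup>+y. \<integral>\<^sup>+x. ?i A (T x) * ?i B (T x + y) \<partial>lborel \<partial>lborel)"
    by (rule lborel_pair.Fubini') simp
  also have "\<dots> = (\<integral>\<^sup>+y. \<integral>\<^sup>+x. ?i A (T x - y) * ?i B (T x) \<partial>lborel \<partial>lborel)"
  proof (rule nn_integral_cong)
    fix y
    have "(\<integral>\<^sup>+x. ?i A (T x - y) * ?i B (T x) \<partial>lborel)
        = (\<integral>\<^sup>+x. ?i A (T (S y + x) - y) * ?i B (T (S y + x)) \<partial>lborel)"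
      by (rule nn_integral_lborel_translate[symmetric]) simp
    then show "(\<integral>\<^sup>+x. ?i A (T x) * ?i B (T x + y) \<partial>lborel)
        = (\<integral>\<^sup>+x. ?i A (T x - y) * ?i B (T x) \<partial>lborel)"
      by (simp add: linear_add[OF lin] S add.commute)
  qed
  also have "\<dots> = (\<integral>\<^sup>+x. \<integral>\<^sup>+y. ?i A (T x - y) * ?i B (T x) \<partial>lborel \<partial>lborel)"
    by (rule lborel_pair.Fubini') simp
  also have "\<dots> = (\<integral>\<^sup>+x. (\<integral>\<^sup>+y. ?i A (T x - y) \<partial>lborel) * ?i B (T x) \<partial>lborel)"
    by (simp add: nn_integral_multc)
  also have "\<dots> = (\<integral>\<^sup>+x. emeasure lborel A * ?i B (T x) \<partial>lborel)"
  proof (rule nn_integral_cong)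
    fix x
    have "(\<integral>\<^sup>+y. ?i A (T x - y) \<partial>lborel) = (\<integral>\<^sup>+y. ?i A (T x + y) \<partial>lborel)"
      using nn_integral_lborel_reflect[of "\<lambda>y. ?i A (T x + y)"] by simp
    also have "\<dots> = emeasure lborel A"
      by (subst nn_integral_lborel_translate) auto
    finally show "(\<integral>\<^sup>+y. ?i A (T x - y) \<partial>lborel) * ?i B (T x) = emeasure lborel A * ?i B (T x)"
      by simp
  qed
  also have "\<dots> = emeasure lborel A * emeasure lborel B"
    by (simp add: nn_integral_cmult M MB)
  finally have eq: "emeasure ?M A * emeasure lborel B = emeasure lborel A * emeasure lborel B" .
  have B: "emeasure lborel B = ennreal (unit_ball_vol (real DIM('a)))"
    by (simp add: B_def emeasure_ball)
  \<comment> \<open>The common factor can be cancelled only because the ball has positive and finite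
    measure.\<close>
  have "unit_ball_vol (real DIM('a)) > 0" by simp
  with B have "emeasure lborel B \<noteq> 0" "emeasure lborel B \<noteq> top"
    by (auto simp del: unit_ball_vol_pos)
  then show "emeasure ?M A = emeasure lborel A"
    by (metis eq mult_divide_eq_ennreal)
qed simp

lemma nn_integral_lborel_rotate:
  fixes f :: "complex \<Rightarrow> ennreal"
  assumes [measurable]: "f \<in> borel_measurable borel" and c: "cmod c = 1"
  shows "(\<integral>\<^sup>+z. f (c * z) \<partial>lborel) = (\<integral>\<^sup>+z. f z \<partial>lborel)"
proof -
  have "orthogonal_transformation ((*) c)"
    using c by (simp add: orthogonal_transformation norm_mult linear_times)
  then have "(\<integral>\<^sup>+z. f z \<partial>lborel) = (\<integral>\<^sup>+z. f z \<partial>distr lborel borel ((*) c))"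
    by (simp add: distr_lborel_orthogonal)
  then show ?thesis
    by (simp add: nn_integral_distr)
qed

section \<open>Radial distribution of normalized area\<close>

text \<open>The disc of radius sqrt r has normalized area r, so both measures give the ray above x
  the mass 1 - r, with r the truncation of x to [0,1]; finite values on all such rays determine the
  measure.\<close>

lemma distr_disc_area_norm_square:
  "distr disc_area borel (\<lambda>z. (cmod z)\<^sup>2) = density lborel (indicator {0..1})" (is "?M = ?N")
proof (rule measure_eqI_lessThan)
  fix x :: real
  have m: "(\<lambda>z. (cmod z)\<^sup>2) \<in> disc_area \<rightarrow>\<^sub>M borel"
    by (auto simp: disc_area_def cong: measurable_cong_sets intro!: measurable_restrict_space1)
  have N: "emeasure ?N {x<..} = ennreal (1 - min 1 (max 0 x))"
  proof -
    have "emeasure ?N {x<..} = emeasure lborel ({0..1} \<inter> {x<..})"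
      by (simp add: emeasure_density indicator_inter_arith[symmetric])
    also have "{0..1} \<inter> {x<..} = (if x < 0 then {0..1} else {x<..1})" by auto
    finally show ?thesis by (auto simp: min_def max_def)
  qed
  have "emeasure ?M {x<..} = emeasure disc_area ({z. x < (cmod z)\<^sup>2} \<inter> ball 0 1)"
    using m by (subst emeasure_distr) (auto simp: disc_area_def space_restrict_space vimage_def Int_def)
  also have "\<dots> = ennreal (1/pi) * emeasure lborel ({z. x < (cmod z)\<^sup>2} \<inter> ball 0 1)"
  proof -
    have [measurable]: "{z. x < (cmod z)\<^sup>2} \<inter> ball 0 1 \<in> sets (restrict_space lborel unit_disc)"
      by (subst sets_restrict_space_iff) auto
    show ?thesis
      unfolding disc_area_def
      by (subst emeasure_density) (auto simp: nn_integral_cmult_indicator emeasure_restrict_space)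
  qed
  also have "\<dots> = ennreal (1 - min 1 (max 0 x))"
  proof -
    define r where "r = min 1 (max 0 x)"
    have r: "0 \<le> r" "r \<le> 1" by (auto simp: r_def)
    have le: "cmod z \<le> sqrt r \<longleftrightarrow> (cmod z)\<^sup>2 \<le> r" for z
      using r by (metis norm_ge_zero real_sqrt_le_iff real_sqrt_pow2 real_sqrt_unique real_sqrt_abs abs_norm_cancel)
    have less: "cmod z < 1 \<longleftrightarrow> (cmod z)\<^sup>2 < 1" for z
      using abs_square_less_1[of "cmod z"] by simp
    \<comment> \<open>For x < 0 the origin satisfies x < |z|^2, but removing the closed disc of
      radius sqrt r = 0 would delete it; hence the separate case.\<close>
    have eq: "{z. x < (cmod z)\<^sup>2} \<inter> ball 0 1 = (if x < 0 then ball 0 1 else ball 0 1 - cball 0 (sqrt r))"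
      by (auto simp: le less) (auto simp: r_def not_le intro: less_le_trans[OF _ zero_le_power2])
    have "emeasure lborel (ball (0::complex) 1) = ennreal pi"
      by (simp add: emeasure_ball unit_ball_vol_2)
    moreover have "emeasure lborel (ball 0 1 - cball (0::complex) (sqrt r)) = ennreal (pi - pi * r)" if "\<not> x < 0"
    \<comment> \<open>At r = 1 the closed disc is not contained in the open one, so measures cannot
      be subtracted; there the difference set is empty.\<close>
    proof (cases "r = 1")
      case True
      then have "ball 0 1 - cball (0::complex) (sqrt r) = {}" by auto
      with True show ?thesis by (metis emeasure_empty diff_self ennreal_0 mult.right_neutral)
    next
      case False
      with r have "sqrt r < 1" by simp
      then have "cball (0::complex) (sqrt r) \<subseteq> ball 0 1" by (auto intro: le_less_trans simp del: real_sqrt_lt_1_iff)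
      then show ?thesis using r
        by (subst emeasure_Diff) (auto simp: emeasure_ball emeasure_cball unit_ball_vol_2 ennreal_minus)
    qed
    ultimately show ?thesis using r
      by (auto simp: eq ennreal_mult'[symmetric] field_simps r_def[symmetric]) (simp add: r_def)
  qed
  finally have M: "emeasure ?M {x<..} = ennreal (1 - min 1 (max 0 x))" .
  then show "emeasure ?M {x<..} < \<infinity>" by (simp only: ennreal_less_top infinity_ennreal_def)
  show "emeasure ?M {x<..} = emeasure ?N {x<..}" by (simp only: M N)
qed auto

section \<open>Parseval's identity on circles\<close>

text \<open>For m nonzero the antiderivative exp (w t) / w has equal values at 0 and 1, since exp w
  = 1. Angles are parametrized by [0,1], so no factor 2 pi enters later.\<close>

lemma has_integral_cis_int:
  fixes m :: int
  shows "((\<lambda>t. cis (2 * pi * of_int m * t)) has_integral (if m = 0 then 1 else 0)) {0..1}"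
proof (cases "m = 0")
  case True
  then show ?thesis
    using has_integral_const_real[of "1::complex" 0 1] by simp
next
  case False
  define w where "w = 2 * pi * of_int m * \<i>"
  have w: "w \<noteq> 0" using False by (simp add: w_def)
  have "((\<lambda>t. exp (w * of_real t)) has_integral exp (w * of_real 1) / w - exp (w * of_real 0) / w) {0..1}"
  proof (rule fundamental_theorem_of_calculus)
    fix t :: real assume "t \<in> {0..1}"
    have "((\<lambda>z. exp (w * z) / w) has_field_derivative exp (w * of_real t)) (at (of_real t))"
      using w by (auto intro!: derivative_eq_intros)
    then show "((\<lambda>t. exp (w * of_real t) / w) has_vector_derivative exp (w * of_real t)) (at t within {0..1})"
      by (rule has_vector_derivative_real_field)
  qed simp
  moreover have "exp w = 1"
    using exp_integer_2pi[of "of_int m"] by (simp add: w_def mult_ac)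
  ultimately show ?thesis
    using False by (simp add: cis_conv_exp w_def mult_ac)
qed

text \<open>The squared modulus expands into a double sum with integer frequencies j - k, and by
  orthogonality only the diagonal survives integration.\<close>

lemma has_integral_circle_trig_poly:
  fixes u :: "nat \<Rightarrow> complex"
  shows "((\<lambda>t. (cmod (\<Sum>k<n. u k * cis (2 * pi * t) ^ k))\<^sup>2) has_integral (\<Sum>k<n. (cmod (u k))\<^sup>2)) {0..1}"
proof -
  have eq: "(\<Sum>j<n. \<Sum>k<n. u j * cnj (u k) * cis (2 * pi * of_int (int j - int k) * t))
      = of_real ((cmod (\<Sum>k<n. u k * cis (2 * pi * t) ^ k))\<^sup>2)" for t
  proof -
    have "u j * cis (2 * pi * t) ^ j * cnj (u k * cis (2 * pi * t) ^ k)
        = u j * cnj (u k) * cis (2 * pi * of_int (int j - int k) * t)" for j k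
    proof -
      have "cis (2 * pi * t) ^ j * cnj (cis (2 * pi * t) ^ k) = cis (2 * pi * of_int (int j - int k) * t)"
        unfolding Complex.DeMoivre cis_cnj cis_mult by (rule arg_cong[where f = cis]) (simp add: algebra_simps)
      then show ?thesis by (simp add: mult_ac)
    qed
    then show ?thesis
      unfolding complex_norm_square cnj_sum sum_product by (simp only:)
  qed
  have "((\<lambda>t. \<Sum>j<n. \<Sum>k<n. u j * cnj (u k) * cis (2 * pi * of_int (int j - int k) * t))
      has_integral (\<Sum>j<n. \<Sum>k<n. u j * cnj (u k) * (if int j - int k = 0 then 1 else 0))) {0..1}"
    by (intro has_integral_sum has_integral_mult_right has_integral_cis_int) auto
  also have "(\<Sum>j<n. \<Sum>k<n. u j * cnj (u k) * (if int j - int k = 0 then 1 else 0))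
      = of_real (\<Sum>k<n. (cmod (u k))\<^sup>2)"
    by (simp add: if_distrib complex_norm_square del: of_real_power cong: if_cong)
  finally have "((\<lambda>t. complex_of_real ((cmod (\<Sum>k<n. u k * cis (2 * pi * t) ^ k))\<^sup>2))
      has_integral of_real (\<Sum>k<n. (cmod (u k))\<^sup>2)) {0..1}"
    by (simp only: eq)
  from has_integral_Re[OF this] show ?thesis by simp
qed

text \<open>Dominated convergence from the partial sums; absolute summability supplies the constant
  bound (sum |u_k|)^2. It is applied with u_k = a_k z^k, on the circle through z.\<close>

lemma has_integral_circle_power_series:
  fixes u :: "nat \<Rightarrow> complex"
  assumes u: "summable (\<lambda>k. cmod (u k))"
    and g: "\<And>t. (\<lambda>k. u k * cis (2 * pi * t) ^ k) sums g t"
  shows "((\<lambda>t. (cmod (g t))\<^sup>2) has_integral (\<Sum>k. (cmod (u k))\<^sup>2)) {0..1}"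
    and "summable (\<lambda>k. (cmod (u k))\<^sup>2)"
proof -
  show "summable (\<lambda>k. (cmod (u k))\<^sup>2)"
  proof (rule summable_comparison_test_ev[OF _ u])
    \<comment> \<open>Once |u_k| < 1, its square is at most |u_k|.\<close>
    have "eventually (\<lambda>k. cmod (u k) < 1) sequentially"
      using summable_LIMSEQ_zero[OF u] by (rule order_tendstoD) simp
    then show "eventually (\<lambda>k. norm ((cmod (u k))\<^sup>2) \<le> cmod (u k)) sequentially"
      by eventually_elim (simp add: power2_eq_square mult_left_le)
  qed
  show "((\<lambda>t. (cmod (g t))\<^sup>2) has_integral (\<Sum>k. (cmod (u k))\<^sup>2)) {0..1}"
  proof (rule has_integral_dominated_convergence)
    show "((\<lambda>t. (cmod (\<Sum>k<n. u k * cis (2 * pi * t) ^ k))\<^sup>2) has_integral (\<Sum>k<n. (cmod (u k))\<^sup>2)) {0..1}" for n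
      by (rule has_integral_circle_trig_poly)
    show "(\<lambda>t. (\<Sum>k. cmod (u k))\<^sup>2) integrable_on {0..1::real}"
      by (rule integrable_const_ivl)
    show "\<forall>t\<in>{0..1}. norm ((cmod (\<Sum>k<n. u k * cis (2 * pi * t) ^ k))\<^sup>2) \<le> (\<Sum>k. cmod (u k))\<^sup>2" for n
    proof
      fix t
      have "cmod (\<Sum>k<n. u k * cis (2 * pi * t) ^ k) \<le> (\<Sum>k<n. cmod (u k))"
        by (rule sum_norm_le) (simp add: norm_mult norm_power)
      also have "\<dots> \<le> (\<Sum>k. cmod (u k))"
        by (rule sum_le_suminf[OF u]) auto
      finally show "norm ((cmod (\<Sum>k<n. u k * cis (2 * pi * t) ^ k))\<^sup>2) \<le> (\<Sum>k. cmod (u k))\<^sup>2"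
        by (simp add: power_mono)
    qed
    show "\<forall>t\<in>{0..1}. (\<lambda>n. (cmod (\<Sum>k<n. u k * cis (2 * pi * t) ^ k))\<^sup>2) \<longlonglongrightarrow> (cmod (g t))\<^sup>2"
      using g by (auto simp: sums_def intro!: tendsto_intros)
    show "(\<lambda>n. \<Sum>k<n. (cmod (u k))\<^sup>2) \<longlonglongrightarrow> (\<Sum>k. (cmod (u k))\<^sup>2)"
      using \<open>summable (\<lambda>k. (cmod (u k))\<^sup>2)\<close> by (rule summable_LIMSEQ)
  qed
qed

section \<open>Weighted Bergman norms of power series\<close>

lemma nn_integral_disc_area:
  assumes [measurable]: "g \<in> borel_measurable (restrict_space lborel unit_disc)"
  shows "(\<integral>\<^sup>+z. g z \<partial>disc_area) = (\<integral>\<^sup>+z. ennreal (1 / pi) * indicator unit_disc z * g z \<partial>lborel)"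
  unfolding disc_area_def
  by (simp add: nn_integral_density nn_integral_restrict_space mult_ac)

lemma nn_integral_weighted_area:
  assumes [measurable]: "g \<in> borel_measurable (restrict_space lborel unit_disc)"
  shows "(\<integral>\<^sup>+z. g z \<partial>weighted_area \<alpha>)
    = (\<integral>\<^sup>+z. ennreal ((1 + \<alpha>) * (1 - (cmod z)\<^sup>2) powr \<alpha>) * g z \<partial>disc_area)"
proof -
  have [simp]: "borel_measurable disc_area = (borel_measurable (restrict_space lborel unit_disc) :: (complex \<Rightarrow> ennreal) set)"
    by (auto simp: disc_area_def cong: measurable_cong_sets)
  show ?thesis
    unfolding weighted_area_def
    by (subst nn_integral_density) (auto intro!: measurable_restrict_space1)
qed

text \<open>This is Gamma (a + 1 + k) = pochhammer (a + 1) k * a * Gamma a. With a = alpha + 1 the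
  factor a in the denominator cancels the normalization 1 + alpha of the weight.\<close>

lemma Beta_Suc_pochhammer:
  fixes a :: real
  assumes "a > 0"
  shows "Beta (real k + 1) a = fact k / (a * pochhammer (a + 1) k)"
proof -
  have "pochhammer (a + 1) k = Gamma (a + 1 + real k) / Gamma (a + 1)"
    using assms by (intro pochhammer_Gamma) (auto elim!: nonpos_Ints_cases)
  moreover have "Gamma (a + 1) = a * Gamma a"
    using assms by (intro Gamma_plus1) (auto elim!: nonpos_Ints_cases)
  moreover have "Gamma a > 0" "Gamma (a + 1 + real k) > 0" using assms by auto
  ultimately show ?thesis using assms
    by (simp add: Beta_def Gamma_fact add_ac field_simps)
qed

lemma nn_integral_weighted_area_monomial:
  assumes "\<alpha> > -1"
  shows "(\<integral>\<^sup>+z. ennreal (cmod z ^ (2 * k)) \<partial>weighted_area \<alpha>) = ennreal (fact k / pochhammer (\<alpha> + 2) k)"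
proof -
  have m: "(\<lambda>z. (cmod z)\<^sup>2) \<in> disc_area \<rightarrow>\<^sub>M borel"
    by (auto simp: disc_area_def cong: measurable_cong_sets intro!: measurable_restrict_space1)
  let ?g = "\<lambda>t::real. t powr (real k + 1 - 1) * (1 - t) powr (\<alpha> + 1 - 1)"
  have "(\<integral>\<^sup>+z. ennreal (cmod z ^ (2 * k)) \<partial>weighted_area \<alpha>)
      = (\<integral>\<^sup>+z. ennreal ((1 + \<alpha>) * (1 - (cmod z)\<^sup>2) powr \<alpha>) * ennreal (((cmod z)\<^sup>2) ^ k) \<partial>disc_area)"
    by (subst nn_integral_weighted_area) (auto simp: power_mult intro!: measurable_restrict_space1)
  also have "\<dots> = (\<integral>\<^sup>+t. ennreal ((1 + \<alpha>) * (1 - t) powr \<alpha>) * ennreal (t ^ k) \<partial>distr disc_area borel (\<lambda>z. (cmod z)\<^sup>2))"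
    using m by (subst nn_integral_distr) auto
  also have "\<dots> = (\<integral>\<^sup>+t\<in>{0..1}. ennreal ((1 + \<alpha>) * (1 - t) powr \<alpha>) * ennreal (t ^ k) \<partial>lborel)"
    by (simp add: distr_disc_area_norm_square nn_integral_density mult_ac)
  also have "\<dots> = (\<integral>\<^sup>+t\<in>{0..1}. ennreal ((1 + \<alpha>) * ?g t) \<partial>lborel)"
  \<comment> \<open>The point t = 0 is discarded because \<open>0 powr 0 = 0\<close> while
    \<open>0 ^ 0 = 1\<close>, so the integrands differ there when k = 0.\<close>
  proof (rule nn_integral_cong_AE, rule AE_mp[OF AE_lborel_singleton[of 0]], intro AE_I2 impI)
    fix t :: real assume "t \<noteq> 0"
    then show "ennreal ((1 + \<alpha>) * (1 - t) powr \<alpha>) * ennreal (t ^ k) * indicator {0..1} t =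
         ennreal ((1 + \<alpha>) * ?g t) * indicator {0..1} t"
      using assms by (auto simp: indicator_def powr_realpow ennreal_mult'[symmetric] mult_ac)
  qed
  also have "\<dots> = ennreal ((1 + \<alpha>) * Beta (real k + 1) (\<alpha> + 1))"
    using assms
    by (intro nn_integral_has_integral_lebesgue' has_integral_mult_right has_integral_Beta_real) auto
  also have "(1 + \<alpha>) * Beta (real k + 1) (\<alpha> + 1) = fact k / pochhammer (\<alpha> + 2) k"
    using assms by (subst Beta_Suc_pochhammer) (auto simp: add_ac)
  finally show ?thesis .
qed

text \<open>Every step is an identity between extended nonnegative quantities, so it holds also when
  both sides are infinite; this yields non-membership as well as membership.\<close>

lemma nn_integral_weighted_area_power_series:
  assumes \<alpha>: "\<alpha> > -1" and f: "\<And>z. z \<in> unit_disc \<Longrightarrow> (\<lambda>k. a k * z ^ k) sums f z"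
  shows "(\<integral>\<^sup>+z. ennreal ((cmod (f z))\<^sup>2) \<partial>weighted_area \<alpha>)
    = (\<Sum>k. ennreal ((cmod (a k))\<^sup>2 * (fact k / pochhammer (\<alpha> + 2) k)))"
proof -
  \<comment> \<open>\<open>G\<close> extends |f|^2 by 0 to the whole plane, where rotation
    invariance and Tonelli are available. \<open>h\<close> is the density of
    \<open>weighted_area \<alpha>\<close> against \<open>lborel\<close>.\<close>
  define G where "G z = ennreal ((cmod (f z))\<^sup>2) * indicator unit_disc z" for z
  define h where "h z = ennreal (1 / pi) * indicator unit_disc z * ennreal ((1 + \<alpha>) * (1 - (cmod z)\<^sup>2) powr \<alpha>)"
    for z :: complex
  have "f holomorphic_on unit_disc"
    by (rule power_series_holomorphic) (use f in auto)
  then have cont: "continuous_on unit_disc f"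
    by (rule holomorphic_on_imp_continuous_on)
  then have fm: "(\<lambda>z. ennreal ((cmod (f z))\<^sup>2)) \<in> borel_measurable (restrict_space borel unit_disc)"
    by (intro measurable_compose[OF borel_measurable_continuous_on_restrict measurable_ennreal])
       (auto intro!: continuous_intros)
  then have Gm[measurable]: "G \<in> borel_measurable borel"
    unfolding G_def by (subst (asm) borel_measurable_restrict_space_iff_ennreal) auto
  have fm': "(\<lambda>z. ennreal ((cmod (f z))\<^sup>2)) \<in> borel_measurable (restrict_space lborel unit_disc)"
    using fm by (simp cong: measurable_cong_sets add: sets_restrict_space)
  have [measurable]: "cis \<in> borel_measurable borel"
    by (intro borel_measurable_continuous_onI continuous_intros)
  have hm[measurable]: "h \<in> borel_measurable borel"
  proof -
    have [measurable]: "unit_disc \<in> sets borel" by simp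
    show ?thesis unfolding h_def by measurable
  qed
  have hW: "(\<integral>\<^sup>+z. g z \<partial>weighted_area \<alpha>) = (\<integral>\<^sup>+z. h z * g z \<partial>lborel)"
    if [measurable]: "g \<in> borel_measurable (restrict_space lborel unit_disc)" for g
  proof -
    have [measurable]: "(\<lambda>z. ennreal ((1 + \<alpha>) * (1 - (cmod z)\<^sup>2) powr \<alpha>))
        \<in> borel_measurable (restrict_space lborel unit_disc)"
      by (rule measurable_restrict_space1) measurable
    show ?thesis
      by (simp add: nn_integral_weighted_area nn_integral_disc_area h_def mult_ac)
  qed
  have circle: "(\<integral>\<^sup>+t\<in>{0..1}. G (cis (2 * pi * t) * z) \<partial>lborel)
      = (\<Sum>k. ennreal ((cmod (a k))\<^sup>2 * cmod z ^ (2 * k)))" if z: "z \<in> unit_disc" for z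
  proof -
    let ?u = "\<lambda>k. a k * z ^ k"
    \<comment> \<open>Convergence at a real point r between |z| and 1 forces absolute convergence at
      z.\<close>
    obtain r where r: "cmod z < r" "r < 1" using z dense by auto
    have "r \<ge> 0" using r norm_ge_zero[of z] by linarith
    then have "summable (\<lambda>k. a k * of_real r ^ k)"
      using f[of "of_real r"] r by (auto simp: sums_iff)
    then have sum: "summable (\<lambda>k. cmod (?u k))"
      by (rule powser_insidea) (use r in auto)
    have g: "(\<lambda>k. ?u k * cis (2 * pi * t) ^ k) sums f (cis (2 * pi * t) * z)" for t
      using f[of "cis (2 * pi * t) * z"] z by (simp add: power_mult_distrib norm_mult mult_ac)
    have "(\<integral>\<^sup>+t\<in>{0..1}. G (cis (2 * pi * t) * z) \<partial>lborel)
        = (\<integral>\<^sup>+t\<in>{0..1}. ennreal ((cmod (f (cis (2 * pi * t) * z)))\<^sup>2) \<partial>lborel)"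
      using z by (simp add: G_def norm_mult)
    also have "\<dots> = ennreal (\<Sum>k. (cmod (?u k))\<^sup>2)"
      by (rule nn_integral_has_integral_lebesgue'[OF _ has_integral_circle_power_series(1)[OF sum g]]) simp
    also have "\<dots> = (\<Sum>k. ennreal ((cmod (?u k))\<^sup>2))"
      using has_integral_circle_power_series(2)[OF sum g] by (intro suminf_ennreal2[symmetric]) auto
    finally show ?thesis
      by (simp add: norm_mult norm_power power_mult_distrib power_mult[symmetric] mult.commute)
  qed
  have "(\<integral>\<^sup>+z. ennreal ((cmod (f z))\<^sup>2) \<partial>weighted_area \<alpha>) = (\<integral>\<^sup>+z. h z * G z \<partial>lborel)"
    by (subst hW[OF fm'], rule nn_integral_cong) (auto simp: h_def G_def indicator_def)
  \<comment> \<open>Since [0,1] has length 1, averaging a constant over t changes nothing; t then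
    becomes the angle of a rotation.\<close>
  also have "\<dots> = (\<integral>\<^sup>+t\<in>{0..1}. (\<integral>\<^sup>+z. h z * G z \<partial>lborel) \<partial>(lborel :: real measure))"
    by (subst nn_integral_cmult_indicator) auto
  also have "\<dots> = (\<integral>\<^sup>+t\<in>{0..1}. (\<integral>\<^sup>+z. h z * G (cis (2 * pi * t) * z) \<partial>lborel) \<partial>lborel)"
  proof (rule nn_integral_cong)
    fix t :: real
    have "(\<integral>\<^sup>+z. h z * G z \<partial>lborel) = (\<integral>\<^sup>+z. h (cis (2 * pi * t) * z) * G (cis (2 * pi * t) * z) \<partial>lborel)"
      by (rule nn_integral_lborel_rotate[symmetric]) auto
    \<comment> \<open>\<open>h\<close> is radial, hence unaffected by the rotation.\<close>
    also have "\<dots> = (\<integral>\<^sup>+z. h z * G (cis (2 * pi * t) * z) \<partial>lborel)"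
      by (simp add: h_def norm_mult indicator_def)
    finally show "(\<integral>\<^sup>+z. h z * G z \<partial>lborel) * indicator {0..1} t
        = (\<integral>\<^sup>+z. h z * G (cis (2 * pi * t) * z) \<partial>lborel) * indicator {0..1} t"
      by simp
  qed
  also have "\<dots> = (\<integral>\<^sup>+t. \<integral>\<^sup>+z. h z * (G (cis (2 * pi * t) * z) * indicator {0..1} t) \<partial>lborel \<partial>lborel)"
  proof (rule nn_integral_cong)
    fix t :: real
    show "(\<integral>\<^sup>+z. h z * G (cis (2 * pi * t) * z) \<partial>lborel) * indicator {0..1} t
        = (\<integral>\<^sup>+z. h z * (G (cis (2 * pi * t) * z) * indicator {0..1} t) \<partial>lborel)"
      unfolding mult.assoc[symmetric] by (rule nn_integral_multc[symmetric]) measurable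
  qed
  \<comment> \<open>Tonelli makes the circle mean of |f|^2 the inner integral, where Parseval
    evaluates it.\<close>
  also have "\<dots> = (\<integral>\<^sup>+z. \<integral>\<^sup>+t. h z * (G (cis (2 * pi * t) * z) * indicator {0..1} t) \<partial>lborel \<partial>lborel)"
    by (rule lborel_pair.Fubini') measurable
  also have "\<dots> = (\<integral>\<^sup>+z. h z * (\<integral>\<^sup>+t\<in>{0..1}. G (cis (2 * pi * t) * z) \<partial>lborel) \<partial>lborel)"
    by (simp add: nn_integral_cmult)
  also have "\<dots> = (\<integral>\<^sup>+z. h z * (\<Sum>k. ennreal ((cmod (a k))\<^sup>2 * cmod z ^ (2 * k))) \<partial>lborel)"
  proof (rule nn_integral_cong)
    fix z :: complex
    show "h z * (\<integral>\<^sup>+t\<in>{0..1}. G (cis (2 * pi * t) * z) \<partial>lborel)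
        = h z * (\<Sum>k. ennreal ((cmod (a k))\<^sup>2 * cmod z ^ (2 * k)))"
      \<comment> \<open>Off the disc \<open>circle\<close> gives nothing, but there
        \<open>h z = 0\<close>.\<close>
      by (cases "z \<in> unit_disc") (simp_all only: circle, simp add: h_def)
  qed
  also have "\<dots> = (\<Sum>k. \<integral>\<^sup>+z. h z * ennreal ((cmod (a k))\<^sup>2 * cmod z ^ (2 * k)) \<partial>lborel)"
    by (simp add: nn_integral_suminf[symmetric])
  also have "\<dots> = (\<Sum>k. ennreal ((cmod (a k))\<^sup>2 * (fact k / pochhammer (\<alpha> + 2) k)))"
  proof (rule suminf_cong)
    fix k
    have "(\<integral>\<^sup>+z. h z * ennreal ((cmod (a k))\<^sup>2 * cmod z ^ (2 * k)) \<partial>lborel)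
        = ennreal ((cmod (a k))\<^sup>2) * (\<integral>\<^sup>+z. h z * ennreal (cmod z ^ (2 * k)) \<partial>lborel)"
      by (subst nn_integral_cmult[symmetric]) (auto simp: ennreal_mult' mult_ac)
    also have "(\<integral>\<^sup>+z. h z * ennreal (cmod z ^ (2 * k)) \<partial>lborel) = ennreal (fact k / pochhammer (\<alpha> + 2) k)"
      by (subst hW[symmetric]) (auto intro!: measurable_restrict_space1 nn_integral_weighted_area_monomial[OF \<alpha>])
    finally show "(\<integral>\<^sup>+z. h z * ennreal ((cmod (a k))\<^sup>2 * cmod z ^ (2 * k)) \<partial>lborel)
        = ennreal ((cmod (a k))\<^sup>2 * (fact k / pochhammer (\<alpha> + 2) k))"
      by (simp only: ennreal_mult'[symmetric] zero_le_power2)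
  qed
  finally show ?thesis .
qed

section \<open>Coefficient asymptotics and summability\<close>

text \<open>The quotient \<open>pochhammer s k / fact k\<close> is (-1)^k times the generalized
  binomial coefficient of -s over k, whose asymptotics are known. With \<open>rGamma\<close> in
  place of 1 / Gamma the limit is 0 at s = 0, -1, -2, ..., so all real s are covered.\<close>

lemma pochhammer_over_fact_asymptotic:
  fixes s :: real
  shows "(\<lambda>k. pochhammer s k / fact k / real k powr (s - 1)) \<longlonglongrightarrow> rGamma s"
proof (rule Lim_transform_eventually)
  show "(\<lambda>k. ((- s) gchoose k) / ((-1) ^ k / exp ((- s + 1) * of_real (ln (real k))))) \<longlonglongrightarrow> rGamma s"
    using gbinomial_asymptotic[of "- s"] by (simp add: rGamma_inverse_Gamma)
  show "eventually (\<lambda>k. ((- s) gchoose k) / ((-1) ^ k / exp ((- s + 1) * of_real (ln (real k))))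
      = pochhammer s k / fact k / real k powr (s - 1)) sequentially"
    \<comment> \<open>At k = 0 \<open>powr\<close> has the default value 0, whereas
      \<open>exp\<close> never vanishes.\<close>
    using eventually_gt_at_top[of 0]
  proof eventually_elim
    case (elim k)
    have "exp ((- s + 1) * ln (real k)) = inverse (real k powr (s - 1))"
      using elim by (simp add: powr_def exp_minus[symmetric] algebra_simps)
    then show ?case
      by (simp add: gbinomial_pochhammer field_simps)
  qed
qed

text \<open>An upper bound survives even where the limit vanishes.\<close>

lemma pochhammer_over_fact_bigo:
  fixes s :: real
  shows "(\<lambda>k. pochhammer s k / fact k) \<in> O(\<lambda>k. real k powr (s - 1))"
  using pochhammer_over_fact_asymptotic[of s]
  by (rule bigoI_tendsto) (use eventually_gt_at_top[of 0] in \<open>auto elim: eventually_mono\<close>)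

text \<open>For s > 0 the limit \<open>rGamma s\<close> is nonzero, which gives the lower bound
  too.\<close>

lemma pochhammer_over_fact_bigtheta:
  fixes s :: real
  assumes "s > 0"
  shows "(\<lambda>k. pochhammer s k / fact k) \<in> \<Theta>(\<lambda>k. real k powr (s - 1))"
  using assms by (intro bigthetaI_tendsto[OF _ pochhammer_over_fact_asymptotic])
    (auto simp: rGamma_eq_zero_iff elim!: nonpos_Ints_cases)

text \<open>The p-series test, transferred by comparison in both directions; nonnegativity turns
  summability of f into the absolute summability that comparison requires.\<close>

lemma summable_bigtheta_powr_iff:
  assumes "f \<in> \<Theta>(\<lambda>k. real k powr p)" and nonneg: "\<And>k. f k \<ge> (0::real)"
  shows "summable f \<longleftrightarrow> p < -1"
proof -
  have "summable f" if "p < -1"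
    using that assms by (intro summable_comparison_test_bigo[of "\<lambda>k. real k powr p" f])
      (auto simp: summable_real_powr_iff bigtheta_def)
  moreover have "summable (\<lambda>k. real k powr p)" if "summable f"
  proof (rule summable_comparison_test_bigo)
    show "summable (\<lambda>k. norm (f k))" using that nonneg by simp
    show "(\<lambda>k. real k powr p) \<in> O(f)" using assms(1) by (simp add: bigtheta_sym[of f] bigthetaD1)
  qed
  ultimately show ?thesis by (auto simp: summable_real_powr_iff)
qed

section \<open>The Taylor expansion of \<open>f_pow\<close>\<close>

text \<open>\<open>hardy_space\<close> only asserts that some coefficients exist; uniqueness ties
  them to the explicit ones, as refuting membership demands.\<close>

lemma power_series_coeff_unique:
  fixes a b :: "nat \<Rightarrow> complex"
  assumes "\<And>z. z \<in> unit_disc \<Longrightarrow> (\<lambda>k. a k * z ^ k) sums f z"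
    and "\<And>z. z \<in> unit_disc \<Longrightarrow> (\<lambda>k. b k * z ^ k) sums f z"
  shows "a = b"
proof -
  have ev: "eventually (\<lambda>z. z \<in> unit_disc) (nhds (0::complex))"
    by (intro eventually_nhds_in_open) auto
  have "f has_fps_expansion Abs_fps a" "f has_fps_expansion Abs_fps b"
    by (rule has_fps_expansionI, use ev assms in \<open>auto elim: eventually_mono\<close>)+
  then have "Abs_fps a = Abs_fps b"
    by (rule fps_expansion_unique_complex)
  then show ?thesis
    by (simp add: fps_eq_iff fun_eq_iff)
qed

text \<open>Binomial series with exponent -(2 + beta) at the point -z: the sign (-1)^k of the
  binomial coefficient cancels that of (-z)^k.\<close>

lemma f_pow_sums:
  assumes "z \<in> unit_disc"
  shows "(\<lambda>k. of_real (pochhammer (2 + \<beta>) k / fact k) * z ^ k) sums f_pow \<beta> z"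
proof -
  let ?s = "complex_of_real (2 + \<beta>)"
  have "(\<lambda>k. ((- ?s) gchoose k) * (- z) ^ k) sums (1 + (- z)) powr (- ?s)"
    using assms by (intro gen_binomial_complex) auto
  moreover have "((- ?s) gchoose k) * (- z) ^ k = of_real (pochhammer (2 + \<beta>) k / fact k) * z ^ k" for k
  proof -
    have "((- ?s) gchoose k) * (- z) ^ k = ((-1) ^ k * (-1) ^ k) * (pochhammer ?s k / fact k * z ^ k)"
      unfolding gbinomial_pochhammer power_minus[of z] minus_minus
      by (simp only: mult_ac times_divide_eq_left times_divide_eq_right)
    also have "((-1) ^ k * (-1) ^ k :: complex) = 1"
      by (simp flip: power_mult_distrib)
    finally show ?thesis by (simp only: pochhammer_of_real of_real_divide of_real_fact mult_1)
  qed
  ultimately show ?thesis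
    by (simp only: f_pow_def powr_minus add_uminus_conv_diff inverse_eq_divide)
qed

lemma f_pow_holomorphic: "f_pow \<beta> holomorphic_on unit_disc"
proof (rule power_series_holomorphic)
  fix w :: complex assume "w \<in> unit_disc"
  then show "(\<lambda>k. of_real (pochhammer (2 + \<beta>) k / fact k) * (w - 0) ^ k) sums f_pow \<beta> w"
    unfolding diff_zero by (rule f_pow_sums)
qed

section \<open>Membership criteria\<close>

text \<open>For beta > -2 the coefficient asymptotics are two-sided, so convergence is decided
  exactly, including divergence at the endpoint alpha = 2 + 2 beta.\<close>

lemma f_pow_in_bergman_space_iff:
  assumes \<alpha>: "\<alpha> > -1" and \<beta>: "\<beta> > -2"
  shows "f_pow \<beta> \<in> bergman_space \<alpha> \<longleftrightarrow> \<alpha> > 2 + 2 * \<beta>"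
proof -
  define c where "c k = (pochhammer (2 + \<beta>) k / fact k)\<^sup>2 * (fact k / pochhammer (\<alpha> + 2) k)" for k
  have nonneg: "c k \<ge> 0" for k
    using \<alpha> pochhammer_nonneg[of "\<alpha> + 2" k] by (simp add: c_def)
  have "c \<in> \<Theta>(\<lambda>k. (real k powr (2 + \<beta> - 1))\<^sup>2 * inverse (real k powr (\<alpha> + 2 - 1)))"
  proof -
    have "(\<lambda>k. inverse (pochhammer (\<alpha> + 2) k / fact k)) \<in> \<Theta>(\<lambda>k. inverse (real k powr (\<alpha> + 2 - 1)))"
      using \<alpha> by (intro bigtheta_inverse[THEN iffD2, OF pochhammer_over_fact_bigtheta]) simp
    moreover have "(\<lambda>k. (pochhammer (2 + \<beta>) k / fact k)\<^sup>2) \<in> \<Theta>(\<lambda>k. (real k powr (2 + \<beta> - 1))\<^sup>2)"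
      using \<beta> pochhammer_over_fact_bigtheta[of "2 + \<beta>"]
      unfolding power2_eq_square by (intro landau_theta.mult) simp_all
    ultimately have "(\<lambda>k. (pochhammer (2 + \<beta>) k / fact k)\<^sup>2 * inverse (pochhammer (\<alpha> + 2) k / fact k))
        \<in> \<Theta>(\<lambda>k. (real k powr (2 + \<beta> - 1))\<^sup>2 * inverse (real k powr (\<alpha> + 2 - 1)))"
      by (rule landau_theta.mult[rotated])
    then show ?thesis
      unfolding c_def inverse_divide .
  qed
  \<comment> \<open>The exponent is 2 (1 + beta) - (alpha + 1), which is below -1 exactly when alpha
    > 2 + 2 beta.\<close>
  also have "(\<lambda>k. (real k powr (2 + \<beta> - 1))\<^sup>2 * inverse (real k powr (\<alpha> + 2 - 1)))
      = (\<lambda>k. real k powr (2 * \<beta> - \<alpha> + 1))"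
    unfolding power2_eq_square powr_minus[symmetric] powr_add[symmetric] by (simp add: algebra_simps)
  finally have "summable c \<longleftrightarrow> \<alpha> > 2 + 2 * \<beta>"
    using nonneg by (subst summable_bigtheta_powr_iff) auto
  moreover have "(\<integral>\<^sup>+z. ennreal ((cmod (f_pow \<beta> z))\<^sup>2) \<partial>weighted_area \<alpha>) = (\<Sum>k. ennreal (c k))"
    using nn_integral_weighted_area_power_series[OF \<alpha> f_pow_sums[of _ \<beta>]]
    unfolding norm_of_real power2_abs c_def .
  moreover have "(\<Sum>k. ennreal (c k)) < \<infinity> \<longleftrightarrow> summable c"
  proof
    assume "(\<Sum>k. ennreal (c k)) < \<infinity>"
    then show "summable c"
      using nonneg by (intro summable_suminf_not_top) auto
  next
    assume "summable c"
    then show "(\<Sum>k. ennreal (c k)) < \<infinity>"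
      using nonneg by (simp add: suminf_ennreal2)
  qed
  ultimately show ?thesis
    by (simp add: bergman_space_def f_pow_holomorphic)
qed

theorem theorem8p5:
  fixes \<beta> :: real
  shows "(\<beta> > -3/2 \<longrightarrow>
            (\<forall>\<alpha>>2 + 2 * \<beta>. f_pow \<beta> \<in> bergman_space \<alpha> - bergman_space (2 + 2 * \<beta>)))
       \<and> (\<beta> = -3/2 \<longrightarrow>
            (\<forall>\<alpha>>-1. f_pow \<beta> \<in> bergman_space \<alpha> - hardy_space))
       \<and> (\<beta> < -3/2 \<longrightarrow> f_pow \<beta> \<in> hardy_space)"
proof (intro conjI impI allI)
  fix \<alpha> assume "\<beta> > -3/2" "\<alpha> > 2 + 2 * \<beta>"
  \<comment> \<open>Here 2 + 2 beta > -1, so the criterion applies both at alpha and at 2 + 2 beta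
    itself, where its strict inequality fails.\<close>
  then show "f_pow \<beta> \<in> bergman_space \<alpha> - bergman_space (2 + 2 * \<beta>)"
    by (simp add: f_pow_in_bergman_space_iff)
next
  fix \<alpha> :: real assume \<beta>: "\<beta> = -3/2" and \<alpha>: "\<alpha> > -1"
  have "f_pow \<beta> \<notin> hardy_space"
  proof
    assume "f_pow \<beta> \<in> hardy_space"
    then obtain a where a: "\<And>z. z \<in> unit_disc \<Longrightarrow> (\<lambda>k. a k * z ^ k) sums f_pow \<beta> z"
      and sum: "summable (\<lambda>k. (cmod (a k))\<^sup>2)"
      unfolding hardy_space_def by blast
    have "a = (\<lambda>k. of_real (pochhammer (2 + \<beta>) k / fact k))"
      by (rule power_series_coeff_unique[OF a f_pow_sums])
    with sum have "summable (\<lambda>k. (pochhammer (2 + \<beta>) k / fact k)\<^sup>2)"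
      by (simp only: norm_of_real power2_abs)
    \<comment> \<open>At beta = -3/2 the exponent is -1: the squared coefficients behave like the
      harmonic series.\<close>
    moreover have "(\<lambda>k. (pochhammer (2 + \<beta>) k / fact k)\<^sup>2) \<in> \<Theta>(\<lambda>k. real k powr (2 + 2 * \<beta>))"
    proof -
      have "(\<lambda>k. real k powr (2 + 2 * \<beta>)) = (\<lambda>k. real k powr (2 + \<beta> - 1) * real k powr (2 + \<beta> - 1))"
        by (simp add: powr_add[symmetric] algebra_simps)
      then show ?thesis
        using \<beta> unfolding power2_eq_square
        by (simp only:) (intro landau_theta.mult pochhammer_over_fact_bigtheta, auto)
    qed
    ultimately have "2 + 2 * \<beta> < -1"
      by (subst (asm) summable_bigtheta_powr_iff) auto
    with \<beta> show False by simp
  qed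
  \<comment> \<open>Since 2 + 2 beta = -1, the Bergman criterion reads alpha > -1.\<close>
  with \<alpha> \<beta> show "f_pow \<beta> \<in> bergman_space \<alpha> - hardy_space"
    by (simp add: f_pow_in_bergman_space_iff)
next
  assume \<beta>: "\<beta> < -3/2"
  \<comment> \<open>Now 2 + beta may be nonpositive, so only the upper bound is at hand; it suffices
    because the squared bound has exponent 2 + 2 beta < -1.\<close>
  have "(\<lambda>k. (pochhammer (2 + \<beta>) k / fact k)\<^sup>2) \<in> O(\<lambda>k. (real k powr (2 + \<beta> - 1))\<^sup>2)"
    by (intro landau_o.big_power pochhammer_over_fact_bigo)
  moreover have "summable (\<lambda>k. norm ((real k powr (2 + \<beta> - 1))\<^sup>2))"
    using \<beta> by (simp add: power2_eq_square summable_real_powr_iff flip: powr_add)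
  ultimately have "summable (\<lambda>k. (pochhammer (2 + \<beta>) k / fact k)\<^sup>2)"
    by (rule summable_comparison_test_bigo[rotated])
  then have "summable (\<lambda>k. (cmod (of_real (pochhammer (2 + \<beta>) k / fact k)))\<^sup>2)"
    by (simp only: norm_of_real power2_abs)
  then show "f_pow \<beta> \<in> hardy_space"
    unfolding hardy_space_def
    by (intro CollectI conjI f_pow_holomorphic
        exI[of _ "\<lambda>k. of_real (pochhammer (2 + \<beta>) k / fact k)"] ballI f_pow_sums)
qed

end
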